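(* Let $F:\mathbb{R}^4\to\mathbb{R}^4$ be the map $$F(x,y,z,w)=\big(y,z,w,\max(0,y,z,w)-x\big).$$ The function $$V_2(x,y,z,w)=\max(0,x,y,z,w,x+w)+\max(0,x,y)+\max(0,y,z)+\max(0,z,w)-x-y-z-w$$ is a first integral of $F$ (on $\mathbb{R}^4$); in other words, it is an invariant function for the recurrence $x_{n+4}=\max\{x_{n+3},x_{n+2},x_{n+1},0\}-x_n$. Furthermore, there exist nonempty open sets in $\mathbb{R}^4$ on which $V_2$ is functionally independent with the first integral $$V_1(x,y,z,w)=\max(0,x,y,z,w)+\max(0,-x)+\max(0,-y)+\max(0,-z)+\max(0,-w).$$
   Context: A first integral of the discrete dynamical system generated by a map $G$ on $\mathbb{R}^n$ is a non-constant function $V:\mathcal{U}\to\mathbb{R}$, defined on a nonempty open set $\mathcal{U}\subseteq\mathbb{R}^n$, that is constant on orbits, i.e. $V(G(\mathbf{x}))=V(\mathbf{x})$ for all $\mathbf{x}\in\mathcal{U}$. Functions $V_1,\dots,V_k$ defined on an open set $\mathcal{U}$ are functionally dependent on $\mathcal{U}$ if there exists a function $R:\mathbb{R}^k\to\mathbb{R}$, not identically zero on any nonempty open subset of $\mathbb{R}^k$, such that $R(V_1(\mathbf{x}),\dots,V_k(\mathbf{x}))=0$ for all $\mathbf{x}\in\mathcal{U}$; otherwise they are functionally independent on $\mathcal{U}$. *)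

theory Defs
  imports "HOL-Analysis.Analysis"
begin

text \<open>A first integral is a function on \<open>U\<close>, so \<open>V (G x) = V x\<close> for \<open>x \<in> U\<close> presupposes
  \<open>G x \<in> U\<close>. Since HOL functions are total, this is stated explicitly.\<close>

definition first_integral ::
  "(real^'n \<Rightarrow> real^'n) \<Rightarrow> (real^'n) set \<Rightarrow> (real^'n \<Rightarrow> real) \<Rightarrow> bool" where
  "first_integral G U V \<longleftrightarrow>
     open U \<and> U \<noteq> {} \<and> \<not> V constant_on U \<and>
     (\<forall>x\<in>U. G x \<in> U \<and> V (G x) = V x)"

text \<open>No regularity of \<open>R\<close> is required.\<close>

definition functionally_dependent_on ::
  "('k::finite \<Rightarrow> real^'n \<Rightarrow> real) \<Rightarrow> (real^'n) set \<Rightarrow> bool" where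
  "functionally_dependent_on V U \<longleftrightarrow>
     (\<exists>R :: real^'k \<Rightarrow> real.
        (\<forall>W. open W \<and> W \<noteq> {} \<longrightarrow> (\<exists>v\<in>W. R v \<noteq> 0)) \<and>
        (\<forall>x\<in>U. R (\<chi> i. V i x) = 0))"

definition functionally_independent_on ::
  "('k::finite \<Rightarrow> real^'n \<Rightarrow> real) \<Rightarrow> (real^'n) set \<Rightarrow> bool" where
  "functionally_independent_on V U \<longleftrightarrow> \<not> functionally_dependent_on V U"

text \<open>The coordinates \<open>x, y, z, w\<close> are \<open>p $ 1, p $ 2, p $ 3, p $ 4\<close>.\<close>

definition F :: "real^4 \<Rightarrow> real^4" where
  "F p = (let x = p $ 1; y = p $ 2; z = p $ 3; w = p $ 4
          in vector [y, z, w, Max {0, y, z, w} - x])"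

definition V1 :: "real^4 \<Rightarrow> real" where
  "V1 p = (let x = p $ 1; y = p $ 2; z = p $ 3; w = p $ 4
           in Max {0, x, y, z, w} + max 0 (-x) + max 0 (-y) + max 0 (-z) + max 0 (-w))"

definition V2 :: "real^4 \<Rightarrow> real" where
  "V2 p = (let x = p $ 1; y = p $ 2; z = p $ 3; w = p $ 4
           in Max {0, x, y, z, w, x + w} + Max {0, x, y} + Max {0, y, z} + Max {0, z, w}
              - x - y - z - w)"

end

theory Submission
  imports Defs
begin

text \<open>With \<open>M = max 0 (max y (max z w))\<close> and \<open>u = M - x\<close>, translating by \<open>x\<close> inside the maxima
  gives \<open>max (max M u) (y + u) - u = max 0 (max x y)\<close> and
  \<open>max (max M x) (x + w) - x = max 0 (max w u)\<close>; hence \<open>F\<close> merely swaps these two contributions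
  to \<open>V2\<close>. On the cone where \<open>x, z, w > 0\<close>, \<open>w < z < y\<close> and \<open>x + w < y\<close>, the pair \<open>(V1, V2)\<close>
  equals \<open>(y, 2 y - x - w)\<close>, whose image is open, so any relation \<open>R\<close> vanishes on an open
  set.\<close>

lemma vector_4_nth [simp]:
  fixes a b c d :: real
  shows "(vector [a, b, c, d] :: real^4) $ 1 = a"
    and "(vector [a, b, c, d] :: real^4) $ 2 = b"
    and "(vector [a, b, c, d] :: real^4) $ 3 = c"
    and "(vector [a, b, c, d] :: real^4) $ 4 = d"
  by (simp_all add: vector_def)

text \<open>Only the terms involving \<open>x\<close> and the new coordinate \<open>u\<close>
  differ. Since \<open>M\<close> is nonnegative, \<open>max M u + max 0 (- u)\<close> and
  \<open>max M x + max 0 (- x)\<close> both equal \<open>max M x\<close> if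
  \<open>0 \<le> x\<close>, and both equal \<open>M - x\<close> if \<open>x < 0\<close>.\<close>

lemma V1_F: "V1 (F p) = V1 p"
proof -
  define x y z w where "x = p $ 1" and "y = p $ 2" and "z = p $ 3" and "w = p $ 4"
  define M where "M = max 0 (max y (max z w))"
  define u where "u = M - x"
  have M: "Max {0, y, z, w} = M" "Max {0, y, z, w, u} = max M u"
    "Max {0, x, y, z, w} = max M x"
    by (simp_all add: M_def ac_simps)
  have "0 \<le> M"
    by (simp add: M_def)
  then have "max M u + max 0 (- u) = max M x + max 0 (- x)"
    unfolding u_def by linarith
  then show ?thesis
    unfolding V1_def F_def Let_def vector_4_nth
    unfolding x_def [symmetric] y_def [symmetric] z_def [symmetric] w_def [symmetric] M(1)
      u_def [symmetric] M(2,3)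
    by simp
qed

lemma V2_F: "V2 (F p) = V2 p"
proof -
  define x y z w where "x = p $ 1" and "y = p $ 2" and "z = p $ 3" and "w = p $ 4"
  define M where "M = max 0 (max y (max z w))"
  define u where "u = M - x"
  have M: "Max {0, y, z, w} = M" "Max {0, y, z, w, u, y + u} = max (max M u) (y + u)"
    "Max {0, x, y, z, w, x + w} = max (max M x) (x + w)"
    by (simp_all add: M_def ac_simps)
  have "max (max M u) (y + u) - u = max 0 (max x y)"
    "max (max M x) (x + w) - x = max 0 (max w u)"
    by (simp_all add: u_def max_diff_distrib_left ac_simps)
  \<comment> \<open>\<open>Max {0, y, z}\<close>, \<open>Max {0, z, w}\<close> and
    \<open>- y - z - w\<close> occur on both sides and cancel.\<close>
  then show ?thesis
    unfolding V2_def F_def Let_def vector_4_nth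
    unfolding x_def [symmetric] y_def [symmetric] z_def [symmetric] w_def [symmetric] M(1)
      u_def [symmetric] M(2,3)
    by simp
qed

lemma first_integral_V1: "first_integral F UNIV V1"
proof -
  have "V1 0 = 0" "V1 (vector [1, 0, 0, 0]) = 1"
    by (simp_all add: V1_def)
  then have "\<not> V1 constant_on UNIV"
    unfolding constant_on_def by (metis UNIV_I zero_neq_one)
  then show ?thesis
    by (simp add: first_integral_def V1_F)
qed

lemma first_integral_V2: "first_integral F UNIV V2"
proof -
  have "V2 0 = 0" "V2 (vector [1, 0, 0, 0]) = 1"
    by (simp_all add: V2_def)
  then have "\<not> V2 constant_on UNIV"
    unfolding constant_on_def by (metis UNIV_I zero_neq_one)
  then show ?thesis
    by (simp add: first_integral_def V2_F)
qed

lemma functionally_independent_onI: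
  fixes V :: "'k::finite \<Rightarrow> real^'n \<Rightarrow> real"
  assumes "open W" "W \<noteq> {}" "W \<subseteq> (\<lambda>x. \<chi> i. V i x) ` U"
  shows "functionally_independent_on V U"
  using assms unfolding functionally_independent_on_def functionally_dependent_on_def
  by (metis (no_types, lifting) image_iff subsetD)

text \<open>The inequalities decide which entry attains each maximum: \<open>z\<close> in
  \<open>Max {0, z, w}\<close>, \<open>y\<close> in all others. The \<open>z\<close> then cancels in
  \<open>V2\<close>.\<close>

definition cone :: "(real^4) set" where
  "cone = {p. 0 < p $ 1 \<and> 0 < p $ 4 \<and> p $ 4 < p $ 3 \<and> p $ 3 < p $ 2 \<and> p $ 1 + p $ 4 < p $ 2}"

lemma open_cone: "open cone"
  unfolding cone_def
  by (intro open_Collect_conj open_Collect_less continuous_intros)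

lemma V1_cone: "p \<in> cone \<Longrightarrow> V1 p = p $ 2"
  by (simp add: cone_def V1_def Let_def max_def)

lemma V2_cone: "p \<in> cone \<Longrightarrow> V2 p = 2 * p $ 2 - p $ 1 - p $ 4"
  by (simp add: cone_def V2_def Let_def max_def)

lemma functionally_independent_on_cone:
  "functionally_independent_on (\<lambda>i :: 2. if i = 1 then V1 else V2) cone"
proof (rule functionally_independent_onI)
  \<comment> \<open>On \<open>cone\<close>, \<open>x + w\<close> ranges between \<open>0\<close> and
    \<open>y\<close>, so \<open>2 * y - x - w\<close> lies between \<open>y\<close> and
    \<open>2 * y\<close>.\<close>
  let ?W = "{v :: real^2. v $ 1 < v $ 2 \<and> v $ 2 < 2 * v $ 1}"
  show "open ?W"
    by (intro open_Collect_conj open_Collect_less continuous_intros)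
  have "vector [2, 3] \<in> ?W"
    by simp
  then show "?W \<noteq> {}"
    by blast
  show "?W \<subseteq> (\<lambda>x. \<chi> i. (if i = 1 then V1 else V2) x) ` cone"
  proof
    fix v :: "real^2"
    assume v: "v \<in> ?W"
    \<comment> \<open>A preimage needs \<open>y = v $ 1\<close> and
      \<open>x + w = 2 * v $ 1 - v $ 2\<close>; take \<open>x = w = s\<close>. Then
      \<open>0 < s < v $ 1 / 2\<close>, so \<open>3 / 4 * v $ 1\<close> lies strictly between
      \<open>w\<close> and \<open>y\<close> and serves as \<open>z\<close>.\<close>
    define s where "s = v $ 1 - v $ 2 / 2"
    let ?p = "vector [s, v $ 1, 3 / 4 * v $ 1, s] :: real^4"
    have p: "?p \<in> cone"
      using v by (simp add: cone_def s_def)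
    have "v = (\<chi> i. (if i = 1 then V1 else V2) ?p)"
      using V1_cone [OF p] V2_cone [OF p] by (simp add: vec_eq_iff forall_2 s_def)
    with p show "v \<in> (\<lambda>x. \<chi> i. (if i = 1 then V1 else V2) x) ` cone"
      by blast
  qed
qed

lemma cone_nonempty: "cone \<noteq> {}"
proof -
  have "vector [1, 4, 2, 1] \<in> cone"
    by (simp add: cone_def)
  then show ?thesis
    by blast
qed

theorem proposition4:
  shows "first_integral F UNIV V2 \<and>
         (\<forall>x :: nat \<Rightarrow> real.
           (\<forall>n. x (n + 4) = Max {x (n + 3), x (n + 2), x (n + 1), 0} - x n) \<longrightarrow>
           (\<forall>n. V2 (vector [x (n + 1), x (n + 2), x (n + 3), x (n + 4)])
                = V2 (vector [x n, x (n + 1), x (n + 2), x (n + 3)]))) \<and>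
         first_integral F UNIV V1 \<and>
         (\<exists>U :: (real^4) set. open U \<and> U \<noteq> {} \<and>
             functionally_independent_on (\<lambda>i :: 2. if i = 1 then V1 else V2) U)"
proof (intro conjI allI impI)
  fix x :: "nat \<Rightarrow> real" and n
  assume "\<forall>n. x (n + 4) = Max {x (n + 3), x (n + 2), x (n + 1), 0} - x n"
  \<comment> \<open>Once the entries of the maximum are put in the order used by \<open>F\<close>,
    the recurrence says that \<open>F\<close> shifts a window of four consecutive terms by
    one.\<close>
  moreover have "{x (n + 3), x (n + 2), x (n + 1), 0} = {0, x (n + 1), x (n + 2), x (n + 3)}"
    by blast
  ultimately have "F (vector [x n, x (n + 1), x (n + 2), x (n + 3)])
      = vector [x (n + 1), x (n + 2), x (n + 3), x (n + 4)]"
    unfolding F_def Let_def vector_4_nth by metis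
  then show "V2 (vector [x (n + 1), x (n + 2), x (n + 3), x (n + 4)])
      = V2 (vector [x n, x (n + 1), x (n + 2), x (n + 3)])"
    using V2_F by metis
next
  show "\<exists>U :: (real^4) set. open U \<and> U \<noteq> {} \<and>
      functionally_independent_on (\<lambda>i :: 2. if i = 1 then V1 else V2) U"
    using open_cone cone_nonempty functionally_independent_on_cone by blast
qed (fact first_integral_V1 first_integral_V2)+

end
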